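(* Let $\mathcal{K}=\{x\in\mathbb{R}^N: x_i>0\ \forall i\}$. Consider a GNN of the form $X^{(l+1)}=\sigma(A^{(l)}X^{(l)}W^{(l)})$, $l\ge 0$, with $X^{(l)}\in\mathbb{R}^{N\times d}$, $A^{(l)}\in\mathbb{R}^{N\times N}$, $W^{(l)}\in\mathbb{R}^{d\times d}$ and $\sigma$ an activation map applied to each column, and suppose that $X^{(l)}_{:,i}\in\mathcal{K}$ for every $l$ and every $i=1,\dots,d$, where $X^{(l)}_{:,i}$ is the $i$-th column of $X^{(l)}$. If there exists $u\in\mathcal{K}$ such that $\lim_{l\to\infty}\max_i d_H(X^{(l)}_{:,i},u)=0$, then $$\lim_{l\to\infty}\mathrm{NumRank}(X^{(l)})=1 .$$
   Context: For $x,y\in\mathcal{K}$ the Hilbert distance is $d_H(x,y)=\log\big(\max_i\frac{x_i}{y_i}\cdot\max_i\frac{y_i}{x_i}\big)$. The numerical rank of a nonzero matrix $X$ is $\mathrm{NumRank}(X)=\|X\|_F^2/\|X\|_2^2$, where $\|\cdot\|_F$ is the Frobenius norm and $\|\cdot\|_2$ the spectral norm. *)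

theory Defs
  imports "HOL-Analysis.Analysis"
begin

definition pos_cone :: "(real ^ 'n) set" where
  "pos_cone = {x. \<forall>i. 0 < x $ i}"

text \<open>Meaningful for arguments in the positive cone only.\<close>

definition hilbert_dist :: "real ^ 'n \<Rightarrow> real ^ 'n \<Rightarrow> real" where
  "hilbert_dist x y = ln ((MAX i. x $ i / y $ i) * (MAX i. y $ i / x $ i))"

definition frobenius_norm :: "real ^ 'd ^ 'n \<Rightarrow> real" where
  "frobenius_norm X = sqrt (\<Sum>i\<in>UNIV. \<Sum>j\<in>UNIV. (X $ i $ j)\<^sup>2)"

text \<open>The spectral norm is the operator norm induced by the Euclidean norms.\<close>

definition spectral_norm :: "real ^ 'd ^ 'n \<Rightarrow> real" where
  "spectral_norm X = onorm (\<lambda>v. X *v v)"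

definition num_rank :: "real ^ 'd ^ 'n \<Rightarrow> real" where
  "num_rank X = (frobenius_norm X)\<^sup>2 / (spectral_norm X)\<^sup>2"

definition map_columns :: "(real ^ 'n \<Rightarrow> real ^ 'n) \<Rightarrow> real ^ 'd ^ 'n \<Rightarrow> real ^ 'd ^ 'n" where
  "map_columns \<sigma> M = (\<chi> i j. \<sigma> (column j M) $ i)"

end

theory Submission imports Defs begin

text \<open>If the column \<open>x\<^sub>j\<close> is at Hilbert distance \<open>\<delta>\<^sub>j\<close> from \<open>u\<close>, then
  \<open>c\<^sub>j u \<le> x\<^sub>j \<le> exp \<delta>\<^sub>j c\<^sub>j u\<close> entrywise with \<open>c\<^sub>j = 1 / max\<^sub>i (u\<^sub>i / x\<^sub>i\<^sub>j)\<close>.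
  So \<open>X\<close> lies between the rank one matrix \<open>u c\<^sup>T\<close> and \<open>exp \<delta>\<close> times it, where \<open>\<delta> = max\<^sub>j \<delta>\<^sub>j\<close>.
  Testing the spectral norm on \<open>c\<close> bounds it below by \<open>|u| |c|\<close>, while the Frobenius norm
  is at most \<open>exp \<delta> |u| |c|\<close>; hence \<open>1 \<le> num_rank X \<le> exp (2 \<delta>)\<close>.\<close>

lemma norm_vec_square:
  fixes x :: "real ^ 'n"
  shows "(norm x)\<^sup>2 = (\<Sum>i\<in>UNIV. (x $ i)\<^sup>2)"
  by (simp add: norm_vec_def L2_set_def sum_nonneg)

lemma frobenius_norm_square:
  "(frobenius_norm X)\<^sup>2 = (\<Sum>i\<in>UNIV. \<Sum>j\<in>UNIV. (X $ i $ j)\<^sup>2)"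
  by (simp add: frobenius_norm_def sum_nonneg)

lemma norm_mult_vec_le_spectral_norm:
  "norm (X *v v) \<le> spectral_norm X * norm v"
  unfolding spectral_norm_def
  by (rule onorm) (rule matrix_vector_mul_bounded_linear)

text \<open>Cauchy-Schwarz on each row bounds the entries of \<open>X *v v\<close>; summing the
  squares over the rows gives the Frobenius norm.\<close>

lemma spectral_norm_le_frobenius_norm: "spectral_norm X \<le> frobenius_norm X"
  unfolding spectral_norm_def
proof (rule onorm_le)
  fix v
  have "(norm (X *v v))\<^sup>2 = (\<Sum>i\<in>UNIV. (X $ i \<bullet> v)\<^sup>2)"
    by (simp add: norm_vec_square matrix_vector_mul_component)
  also have "\<dots> \<le> (\<Sum>i\<in>UNIV. (norm (X $ i))\<^sup>2 * (norm v)\<^sup>2)"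
    by (intro sum_mono) (metis Cauchy_Schwarz_ineq power2_norm_eq_inner)
  also have "\<dots> = (frobenius_norm X * norm v)\<^sup>2"
    by (simp add: power_mult_distrib frobenius_norm_square norm_vec_square[of "X $ _"]
        flip: sum_distrib_right)
  finally show "norm (X *v v) \<le> frobenius_norm X * norm v"
    by (rule power2_le_imp_le) (simp add: frobenius_norm_def sum_nonneg)
qed

lemma num_rank_ge_1:
  assumes "spectral_norm X > 0"
  shows "num_rank X \<ge> 1"
  using assms spectral_norm_le_frobenius_norm[of X]
  by (simp add: num_rank_def divide_simps power_mono)

lemma spectral_norm_ge:
  fixes X :: "real ^ 'd ^ 'n"
  assumes lower: "\<And>i j. c $ j * u $ i \<le> X $ i $ j"
    and nonneg: "\<And>j. 0 \<le> c $ j" "\<And>i. 0 \<le> u $ i"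
  shows "norm u * norm c \<le> spectral_norm X"
proof (cases "c = 0")
  case True
  then show ?thesis
    by (simp add: spectral_norm_def onorm_pos_le matrix_vector_mul_bounded_linear)
next
  case False
  have "(norm c)\<^sup>2 * u $ i \<le> (X *v c) $ i" for i
  proof -
    have "(norm c)\<^sup>2 * u $ i = (\<Sum>j\<in>UNIV. c $ j * u $ i * c $ j)"
      unfolding norm_vec_square sum_distrib_right by (simp add: power2_eq_square mult_ac)
    also have "\<dots> \<le> (\<Sum>j\<in>UNIV. X $ i $ j * c $ j)"
      by (intro sum_mono mult_right_mono lower nonneg)
    finally show ?thesis
      by (simp add: matrix_vector_mult_def)
  qed
  \<comment> \<open>Entrywise domination passes to norms because the entries of \<open>u\<close>,
    hence both sides, are nonnegative.\<close>
  then have "norm ((norm c)\<^sup>2 *\<^sub>R u) \<le> norm (X *v c)"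
    by (intro norm_le_componentwise_cart) (smt (verit) mult_nonneg_nonneg nonneg real_norm_def
        scaleR_conv_of_real vector_scaleR_component zero_le_power2 real_scaleR_def)
  also have "\<dots> \<le> spectral_norm X * norm c"
    by (rule norm_mult_vec_le_spectral_norm)
  \<comment> \<open>One factor \<open>norm c\<close> cancels, which is why \<open>c = 0\<close> was
    treated apart.\<close>
  finally show ?thesis
    using False by (simp add: power2_eq_square mult.commute mult.left_commute)
qed

lemma frobenius_norm_le:
  assumes "\<And>i j. \<bar>X $ i $ j\<bar> \<le> E * (c $ j * u $ i)"
  shows "(frobenius_norm X)\<^sup>2 \<le> E\<^sup>2 * (norm u * norm c)\<^sup>2"
proof -
  have "(frobenius_norm X)\<^sup>2 \<le> (\<Sum>i\<in>UNIV. \<Sum>j\<in>UNIV. (E * (c $ j * u $ i))\<^sup>2)"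
    unfolding frobenius_norm_square by (intro sum_mono) (metis assms abs_ge_zero power2_abs power_mono)
  also have "\<dots> = E\<^sup>2 * (norm u * norm c)\<^sup>2"
    by (simp add: norm_vec_square power_mult_distrib sum_product)
      (simp add: sum_distrib_left mult.commute)
  finally show ?thesis .
qed

text \<open>The scalar \<open>c\<close> is the minimum of the ratios \<open>x $ i / u $ i\<close>,
  and \<open>exp (hilbert_dist x u)\<close> is their maximum divided by that minimum, so every ratio
  lies between \<open>c\<close> and \<open>exp (hilbert_dist x u) * c\<close>.\<close>

lemma hilbert_dist_sandwich:
  fixes x u :: "real ^ 'n"
  assumes x: "x \<in> pos_cone" and u: "u \<in> pos_cone"
  defines "c \<equiv> 1 / (MAX i. u $ i / x $ i)"
  shows "0 < c" "c * u $ i \<le> x $ i" "x $ i \<le> exp (hilbert_dist x u) * (c * u $ i)"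
proof -
  define a b where "a = (MAX i. x $ i / u $ i)" and "b = (MAX i. u $ i / x $ i)"
  have xpos: "0 < x $ i" and upos: "0 < u $ i" for i
    using x u by (auto simp: pos_cone_def)
  have a: "x $ i / u $ i \<le> a" and b: "u $ i / x $ i \<le> b" for i
    by (auto simp: a_def b_def intro: Max_ge)
  have c: "c = 1 / b"
    by (simp add: c_def b_def)
  have "0 < a" "0 < b"
    using a[of i] b[of i] xpos[of i] upos[of i] by (meson divide_pos_pos less_le_trans)+
  \<comment> \<open>Positivity of both maxima lets \<open>exp\<close> undo
    \<open>ln\<close>.\<close>
  moreover have "exp (hilbert_dist x u) = a * b"
    using \<open>0 < a\<close> \<open>0 < b\<close> by (simp add: hilbert_dist_def flip: a_def b_def)
  ultimately show "0 < c" "c * u $ i \<le> x $ i" "x $ i \<le> exp (hilbert_dist x u) * (c * u $ i)"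
    using a[of i] b[of i] xpos[of i] upos[of i] unfolding c by (simp_all add: field_simps)
qed

lemma num_rank_bounds:
  fixes X :: "real ^ 'd ^ 'n"
  assumes pos: "\<And>j. column j X \<in> pos_cone" and u: "u \<in> pos_cone"
  shows "1 \<le> num_rank X"
    and "num_rank X \<le> (exp (MAX j. hilbert_dist (column j X) u))\<^sup>2"
proof -
  define c :: "real ^ 'd" where "c = (\<chi> j. 1 / (MAX i. u $ i / column j X $ i))"
  define E where "E = exp (MAX j. hilbert_dist (column j X) u)"
  note sandwich = hilbert_dist_sandwich[OF pos u]
  have upos: "0 < u $ i" for i
    using u by (simp add: pos_cone_def)
  have cpos: "0 < c $ j" for j
    using sandwich(1)[of j] by (simp add: c_def)
  have lower: "c $ j * u $ i \<le> X $ i $ j" for i j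
    using sandwich(2)[of j i] by (simp add: c_def column_def)
  have upper: "X $ i $ j \<le> E * (c $ j * u $ i)" for i j
  proof -
    have "X $ i $ j \<le> exp (hilbert_dist (column j X) u) * (c $ j * u $ i)"
      using sandwich(3)[of j i] by (simp add: c_def column_def)
    \<comment> \<open>The worst column provides one factor \<open>E\<close> valid for all
      columns.\<close>
    also have "\<dots> \<le> E * (c $ j * u $ i)"
      using cpos[of j] upos[of i] by (intro mult_right_mono) (auto simp: E_def intro: Max_ge)
    finally show ?thesis .
  qed
  \<comment> \<open>Strict positivity makes the spectral norm nonzero, so the quotient in
    \<open>num_rank\<close> can be cleared.\<close>
  have "0 < norm u * norm c"
    using upos cpos by (metis less_irrefl mult_pos_pos zero_index zero_less_norm_iff)
  moreover have "norm u * norm c \<le> spectral_norm X"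
    using lower cpos upos by (intro spectral_norm_ge) (auto intro: less_imp_le)
  ultimately have spec: "0 < spectral_norm X" "(norm u * norm c)\<^sup>2 \<le> (spectral_norm X)\<^sup>2"
    by (auto intro: power_mono)
  show "1 \<le> num_rank X"
    using spec(1) by (rule num_rank_ge_1)
  \<comment> \<open>The lower bound makes the entries positive, so the absolute value is
    harmless.\<close>
  have "\<bar>X $ i $ j\<bar> \<le> E * (c $ j * u $ i)" for i j
    using upper[of i j] lower[of j i] mult_pos_pos[OF cpos[of j] upos[of i]] by linarith
  then have "(frobenius_norm X)\<^sup>2 \<le> E\<^sup>2 * (norm u * norm c)\<^sup>2"
    by (rule frobenius_norm_le)
  also have "\<dots> \<le> E\<^sup>2 * (spectral_norm X)\<^sup>2"
    using spec(2) by (intro mult_left_mono) auto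
  finally show "num_rank X \<le> E\<^sup>2"
    using spec(1) by (simp add: num_rank_def divide_simps)
qed

theorem theorem5p3:
  fixes X :: "nat \<Rightarrow> real ^ 'd ^ 'n"
    and A :: "nat \<Rightarrow> real ^ 'n ^ 'n"
    and W :: "nat \<Rightarrow> real ^ 'd ^ 'd"
    and \<sigma> :: "real ^ 'n \<Rightarrow> real ^ 'n"
    and u :: "real ^ 'n"
  assumes gnn: "\<And>l. X (Suc l) = map_columns \<sigma> (A l ** X l ** W l)"
    and pos: "\<And>l i. column i (X l) \<in> pos_cone"
    and u: "u \<in> pos_cone"
    and conv: "(\<lambda>l. MAX i. hilbert_dist (column i (X l)) u) \<longlonglongrightarrow> 0"
  shows "(\<lambda>l. num_rank (X l)) \<longlonglongrightarrow> 1"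
proof (rule tendsto_sandwich[where f = "\<lambda>_. 1"])
  \<comment> \<open>By continuity of \<open>exp\<close> and squaring, the upper bound tends to the
    square of \<open>exp 0\<close>.\<close>
  show "(\<lambda>l. (exp (MAX i. hilbert_dist (column i (X l)) u))\<^sup>2) \<longlonglongrightarrow> 1"
    using tendsto_power[OF tendsto_exp[OF conv], of 2] by simp
qed (use num_rank_bounds[OF pos u] in auto)

end
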